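(* A functional $\varphi\in\Phi$ is a viscosity solution of the Cauchy problem $$\partial^{ci}_{\tau,w}\varphi(\tau,z,w(\cdot)) + H(\tau,z,w(\cdot),\nabla_z\varphi(\tau,z,w(\cdot)))=0,\ (\tau,z,w(\cdot))\in\mathbb G,\ \tau<\vartheta,\qquad \varphi(\vartheta,z,w(\cdot))=\sigma(z,w(\cdot)),$$ if and only if it satisfies the terminal condition $\varphi(\vartheta,z,w(\cdot))=\sigma(z,w(\cdot))$, $(z,w(\cdot))\in\mathbb R^n\times\mathrm{PC}$, and the inequalities $$p_0+H(\tau,z,w(\cdot),p)\le0\quad\text{for all }(p_0,p)\in D^-\varphi(\tau,z,w(\cdot)),$$ $$q_0+H(\tau,z,w(\cdot),q)\ge0\quad\text{for all }(q_0,q)\in D^+\varphi(\tau,z,w(\cdot)),$$ for every $(\tau,z,w(\cdot))\in\mathbb G$ with $\tau<\vartheta$.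
   Context: **Spaces.** $\mathbb R^n$ has inner product $\langle\cdot,\cdot\rangle$ and norm $\|\cdot\|$. A function $x(\cdot)$ from $[a,b)$ (or $[a,b]$) to $\mathbb R^n$ is piecewise continuous if there are $a=\xi_1<\xi_2<\dots<\xi_k=b$ such that for each $i\in\{1,\dots,k-1\}$ it is continuous on $[\xi_i,\xi_{i+1})$ and has a finite left limit at $\xi_{i+1}$. $\mathrm{PC}([a,b),\mathbb R^n)$ (or $\mathrm{PC}([a,b],\mathbb R^n)$) is the linear space of such functions. Fix $t_0<\vartheta$, $h>0$; $\mathrm{PC}=\mathrm{PC}([-h,0),\mathbb R^n)$, $\mathbb G=[t_0,\vartheta]\times\mathbb R^n\times\mathrm{PC}$. For $w(\cdot)\in\mathrm{PC}$: $\|w(\cdot)\|_1=\int_{-h}^0\|w(\xi)\|d\xi$, $\|w(\cdot)\|_\infty=\sup_{\xi\in[-h,0)}\|w(\xi)\|$. For $\alpha\ge0$, $P(\alpha)=\{(x,r(\cdot))\in\mathbb R^n\times\mathrm{PC}:\|x\|\le\alpha,\ \|r(\cdot)\|_\infty\le\alpha\}$. For a function $x(\cdot)$ defined on $[t-h,t)$, $x_t(\cdot)\in\mathrm{PC}$ denotes $x_t(\xi)=x(t+\xi)$, $\xi\in[-h,0)$. **Data and standing assumptions.** $\mathbb U\subset\mathbb R^l$, $\mathbb V\subset\mathbb R^m$ are nonempty compact sets; $f(t,x,r(\cdot),u,v)\in\mathbb R^n$ and $f^0(t,x,r(\cdot),u,v)\in\mathbb R$ are defined for $(t,x,r(\cdot))\in\mathbb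 G$, $u\in\mathbb R^l$, $v\in\mathbb R^m$; $\sigma:\mathbb R^n\times\mathrm{PC}\to\mathbb R$. Assume: (1) for each $(x,r(\cdot))$, the maps $(t,u,v)\mapsto f(t,x,r(\cdot),u,v)$ and $(t,u,v)\mapsto f^0(t,x,r(\cdot),u,v)$ are continuous on $[t_0,\vartheta]\times\mathbb R^l\times\mathbb R^m$; (2) there is $c_f>0$ with $\|f(t,x,r(\cdot),u,v)\|+|f^0(t,x,r(\cdot),u,v)|\le c_f(1+\|x\|+\|r(\cdot)\|_1+\|r(-h)\|)$ for all $(t,x,r(\cdot))\in\mathbb G$, $u\in\mathbb U$, $v\in\mathbb V$; (3) for every $\alpha>0$ there is $\lambda_f>0$ with $\|f(t,x,r(\cdot),u,v)-f(t,x',r'(\cdot),u,v)\|+|f^0(t,x,r(\cdot),u,v)-f^0(t,x',r'(\cdot),u,v)|\le\lambda_f(\|x-x'\|+\|r(\cdot)-r'(\cdot)\|_1+\|r(-h)-r'(-h)\|)$ for all $t\in[t_0,\vartheta]$, $(x,r(\cdot)),(x',r'(\cdot))\in P(\alpha)$, $u\in\mathbb U$, $v\in\mathbb V$; (4) for all $(t,x,r(\cdot))\in\mathbb G$, $s\in\mathbb R^n$: $\min_{u\in\mathbb U}\max_{v\in\mathbb V}(\langle f(t,x,r(\cdot),u,v),s\rangle+f^0(t,x,r(\cdot),u,v))=\max_{v\in\mathbb V}\min_{u\in\mathbb U}(\langle f(t,x,r(\cdot),u,v),s\rangle+f^0(t,x,r(\cdot),u,v))$; (5) for every $\alpha>0$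 there is $\lambda_\sigma>0$ with $|\sigma(x,r(\cdot))-\sigma(x',r'(\cdot))|\le\lambda_\sigma(\|x-x'\|+\|r(\cdot)-r'(\cdot)\|_1)$ for all $(x,r(\cdot)),(x',r'(\cdot))\in P(\alpha)$. **Hamiltonian.** $H(\tau,z,w(\cdot),s)=\min_{u\in\mathbb U}\max_{v\in\mathbb V}(\langle f(\tau,z,w(\cdot),u,v),s\rangle+f^0(\tau,z,w(\cdot),u,v))$, $(\tau,z,w(\cdot))\in\mathbb G$, $s\in\mathbb R^n$. **Class $\Phi$.** $\Phi$ is the set of functionals $\varphi:\mathbb G\to\mathbb R$ that are continuous in $\tau$ (for each fixed $(z,w(\cdot))$) and such that for every $\alpha>0$ there is $\lambda_\varphi>0$ with $|\varphi(\tau,z,w(\cdot))-\varphi(\tau,z',w'(\cdot))|\le\lambda_\varphi(\|z-z'\|+\|w(\cdot)-w'(\cdot)\|_1)$ for all $\tau\in[t_0,\vartheta]$, $(z,w(\cdot)),(z',w'(\cdot))\in P(\alpha)$. **Viscosity solution.** For $(\tau,z,w(\cdot))\in\mathbb G$ let $\kappa(\cdot)$ be the constant right extension: $\kappa(t)=w(t-\tau)$ for $t\in[\tau-h,\tau)$, $\kappa(t)=z$ for $t\in[\tau,\vartheta]$. For $\delta>0$ let $O^+_\delta(\tau,z)=\{(t,x):t\in[\tau,\min\{\tau+\delta,\vartheta\}],\ x\in\mathbb R^n,\ \|x-z\|\le\delta\}$. $\varphi\in\Phi$ is a viscosity solution of the Cauchy problem if $\varphi(\vartheta,z,w(\cdot))=\sigma(z,w(\cdot))$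 for all $(z,w(\cdot))$ and, for every $(\tau,z,w(\cdot))\in\mathbb G$ with $\tau<\vartheta$, every continuously differentiable $\psi:\mathbb R\times\mathbb R^n\to\mathbb R$ and every $\delta>0$: (a) if $\varphi(\tau,z,w(\cdot))-\psi(\tau,z)\le\varphi(t,x,\kappa_t(\cdot))-\psi(t,x)$ for all $(t,x)\in O^+_\delta(\tau,z)$, then $\partial\psi(\tau,z)/\partial\tau+H(\tau,z,w(\cdot),\nabla_z\psi(\tau,z))\le0$; (b) if $\varphi(\tau,z,w(\cdot))-\psi(\tau,z)\ge\varphi(t,x,\kappa_t(\cdot))-\psi(t,x)$ for all $(t,x)\in O^+_\delta(\tau,z)$, then $\partial\psi(\tau,z)/\partial\tau+H(\tau,z,w(\cdot),\nabla_z\psi(\tau,z))\ge0$. (The symbols $\partial^{ci}_{\tau,w}$, $\nabla_z$ applied to $\varphi$ in the Cauchy problem denote the coinvariant derivative and gradient; they play no role in this definition.) **Sub- and superdifferentials.** For $\varphi:\mathbb G\to\mathbb R$ and $(\tau,z,w(\cdot))\in\mathbb G$, $\tau<\vartheta$, with $\kappa(\cdot)$ the constant right extension of $(\tau,z,w(\cdot))$, i.e. $\kappa(t)=w(t-\tau)$ for $t\in[\tau-h,\tau)$ and $\kappa(t)=z$ for $t\in[\tau,\vartheta]$: $D^-\varphi(\tau,z,w(\cdot))$ is the set of $(p_0,p)\in\mathbb R\times\mathbb R^n$ with $$\lim_{\delta\to0}\inf_{(t,x)\in O^+_\delta(\tau,z)}\frac{\varphi(t,x,\kappa_t(\cdot))-\varphi(\tau,z,w(\cdot))-(t-\tau)p_0-\langle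 x-z,p\rangle}{|t-\tau|+\|x-z\|}\ge0,$$ and $D^+\varphi(\tau,z,w(\cdot))$ is the set of $(q_0,q)\in\mathbb R\times\mathbb R^n$ with $$\lim_{\delta\to0}\sup_{(t,x)\in O^+_\delta(\tau,z)}\frac{\varphi(t,x,\kappa_t(\cdot))-\varphi(\tau,z,w(\cdot))-(t-\tau)q_0-\langle x-z,q\rangle}{|t-\tau|+\|x-z\|}\le0,$$ the infimum and supremum being over $(t,x)\ne(\tau,z)$. *)

theory Defs
  imports "HOL-Analysis.Analysis"
begin

definition piecewise_continuous :: "real \<Rightarrow> real \<Rightarrow> (real \<Rightarrow> 'a::topological_space) \<Rightarrow> bool" where
  "piecewise_continuous a b x \<longleftrightarrow>
     (\<exists>k::nat. \<exists>\<xi>::nat \<Rightarrow> real. 2 \<le> k \<and> \<xi> 1 = a \<and> \<xi> k = b \<and>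
        (\<forall>i\<in>{1..<k}. \<xi> i < \<xi> (i + 1) \<and>
           continuous_on {\<xi> i..<\<xi> (i + 1)} x \<and>
           (\<exists>l. (x \<longlongrightarrow> l) (at_left (\<xi> (i + 1))))))"

text \<open>
  A function defined on \<open>[-h, 0)\<close> only is represented by the total function that agrees
  with it there and is \<open>undefined\<close> elsewhere, so that equality of representatives is
  equality of functions on \<open>[-h, 0)\<close>.
\<close>

definition PC :: "real \<Rightarrow> (real \<Rightarrow> 'a::topological_space) set" where
  "PC h = {w \<in> extensional {-h..<0}. piecewise_continuous (-h) 0 w}"

definition GG :: "real \<Rightarrow> real \<Rightarrow> real \<Rightarrow> (real \<times> (real^'n) \<times> (real \<Rightarrow> real^'n)) set" where
  "GG t0 \<theta> h = {t0..\<theta>} \<times> UNIV \<times> PC h"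

definition norm_1 :: "real \<Rightarrow> (real \<Rightarrow> 'a::real_normed_vector) \<Rightarrow> real" where
  "norm_1 h w = integral {-h..<0} (\<lambda>\<xi>. norm (w \<xi>))"

definition norm_inf :: "real \<Rightarrow> (real \<Rightarrow> 'a::real_normed_vector) \<Rightarrow> real" where
  "norm_inf h w = (SUP \<xi>\<in>{-h..<0}. norm (w \<xi>))"

definition PB :: "real \<Rightarrow> real \<Rightarrow> ((real^'n) \<times> (real \<Rightarrow> real^'n)) set" where
  "PB h \<alpha> = {(x, r). r \<in> PC h \<and> norm x \<le> \<alpha> \<and> norm_inf h r \<le> \<alpha>}"

definition segment :: "real \<Rightarrow> real \<Rightarrow> (real \<Rightarrow> 'a) \<Rightarrow> (real \<Rightarrow> 'a)" where
  "segment h t x = (\<lambda>\<xi>\<in>{-h..<0}. x (t + \<xi>))"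

text \<open>
  The constant right extension \<open>\<kappa>\<close> is only ever used on \<open>[\<tau> - h, \<theta>]\<close>.
\<close>

definition const_ext :: "real \<Rightarrow> 'a \<Rightarrow> (real \<Rightarrow> 'a) \<Rightarrow> (real \<Rightarrow> 'a)" where
  "const_ext \<tau> z w = (\<lambda>t. if t < \<tau> then w (t - \<tau>) else z)"

text \<open>
  Minima over \<open>U\<close> and maxima over \<open>V\<close> are written as infima and suprema of real numbers.
  They are applied to compact nonempty \<open>U\<close>, \<open>V\<close> and to integrands jointly continuous
  in \<open>(u, v)\<close>, where they are attained.
\<close>

definition minmax :: "'u set \<Rightarrow> 'v set \<Rightarrow> ('u \<Rightarrow> 'v \<Rightarrow> real) \<Rightarrow> real" where
  "minmax U V g = (INF u\<in>U. SUP v\<in>V. g u v)"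

definition maxmin :: "'u set \<Rightarrow> 'v set \<Rightarrow> ('u \<Rightarrow> 'v \<Rightarrow> real) \<Rightarrow> real" where
  "maxmin U V g = (SUP v\<in>V. INF u\<in>U. g u v)"

definition hamiltonian ::
  "'u set \<Rightarrow> 'v set \<Rightarrow>
   (real \<Rightarrow> real^'n \<Rightarrow> (real \<Rightarrow> real^'n) \<Rightarrow> 'u \<Rightarrow> 'v \<Rightarrow> real^'n) \<Rightarrow>
   (real \<Rightarrow> real^'n \<Rightarrow> (real \<Rightarrow> real^'n) \<Rightarrow> 'u \<Rightarrow> 'v \<Rightarrow> real) \<Rightarrow>
   real \<Rightarrow> real^'n \<Rightarrow> (real \<Rightarrow> real^'n) \<Rightarrow> real^'n \<Rightarrow> real" where
  "hamiltonian U V f f0 \<tau> z w s = minmax U V (\<lambda>u v. f \<tau> z w u v \<bullet> s + f0 \<tau> z w u v)"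

definition Phi ::
  "real \<Rightarrow> real \<Rightarrow> real \<Rightarrow> (real \<Rightarrow> real^'n \<Rightarrow> (real \<Rightarrow> real^'n) \<Rightarrow> real) set" where
  "Phi t0 \<theta> h = {\<phi>.
     (\<forall>z. \<forall>w\<in>PC h. continuous_on {t0..\<theta>} (\<lambda>\<tau>. \<phi> \<tau> z w)) \<and>
     (\<forall>\<alpha>>0. \<exists>L>0. \<forall>\<tau>\<in>{t0..\<theta>}. \<forall>(z, w)\<in>PB h \<alpha>. \<forall>(z', w')\<in>PB h \<alpha>.
        \<bar>\<phi> \<tau> z w - \<phi> \<tau> z' w'\<bar> \<le> L * (norm (z - z') + norm_1 h (\<lambda>\<xi>. w \<xi> - w' \<xi>)))}"

definition O_plus :: "real \<Rightarrow> real \<Rightarrow> real \<Rightarrow> real^'n \<Rightarrow> (real \<times> (real^'n)) set" where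
  "O_plus \<theta> \<delta> \<tau> z = {(t, x). \<tau> \<le> t \<and> t \<le> min (\<tau> + \<delta>) \<theta> \<and> norm (x - z) \<le> \<delta>}"

definition continuously_differentiable :: "('a::real_inner \<Rightarrow> real) \<Rightarrow> bool" where
  "continuously_differentiable \<psi> \<longleftrightarrow> (\<exists>D. continuous_on UNIV D \<and> (\<forall>y. GDERIV \<psi> y :> D y))"

definition partial_t :: "(real \<times> 'a \<Rightarrow> real) \<Rightarrow> real \<Rightarrow> 'a \<Rightarrow> real" where
  "partial_t \<psi> \<tau> z = deriv (\<lambda>t. \<psi> (t, z)) \<tau>"

definition grad_z :: "(real \<times> 'a::real_inner \<Rightarrow> real) \<Rightarrow> real \<Rightarrow> 'a \<Rightarrow> 'a" where
  "grad_z \<psi> \<tau> z = (THE g. GDERIV (\<lambda>x. \<psi> (\<tau>, x)) z :> g)"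

lemma gderiv_components:
  fixes \<psi> :: "real \<times> 'a::real_inner \<Rightarrow> real"
  assumes "GDERIV \<psi> (\<tau>, z) :> D"
  shows "partial_t \<psi> \<tau> z = fst D" and "grad_z \<psi> \<tau> z = snd D"
proof -
  have D: "(\<psi> has_derivative (\<lambda>y. y \<bullet> D)) (at (\<tau>, z))"
    using assms by (simp add: gderiv_def)
  have "((\<lambda>t. \<psi> (t, z)) has_derivative (\<lambda>s. (s, 0) \<bullet> D)) (at \<tau>)"
    by (rule has_derivative_compose[where g = \<psi> and f = "\<lambda>t. (t, z)", OF _ D])
       (auto intro!: derivative_eq_intros)
  then have "((\<lambda>t. \<psi> (t, z)) has_real_derivative fst D) (at \<tau>)"
    by (simp add: has_field_derivative_def inner_prod_def mult.commute[of _ "fst D"])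
  then show "partial_t \<psi> \<tau> z = fst D"
    by (simp add: partial_t_def DERIV_imp_deriv)
  have "((\<lambda>x. \<psi> (\<tau>, x)) has_derivative (\<lambda>s. (0, s) \<bullet> D)) (at z)"
    by (rule has_derivative_compose[where g = \<psi> and f = "\<lambda>x. (\<tau>, x)", OF _ D])
       (auto intro!: derivative_eq_intros)
  then have g: "GDERIV (\<lambda>x. \<psi> (\<tau>, x)) z :> snd D"
    by (simp add: gderiv_def inner_prod_def)
  show "grad_z \<psi> \<tau> z = snd D"
    unfolding grad_z_def
  proof (rule the_equality, rule g)
    fix g' assume "GDERIV (\<lambda>x. \<psi> (\<tau>, x)) z :> g'"
    with g have "(\<lambda>h. h \<bullet> snd D) = (\<lambda>h. h \<bullet> g')"
      unfolding gderiv_def by (rule has_derivative_unique)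
    then have "\<And>h. h \<bullet> g' = h \<bullet> snd D"
      by (simp add: fun_eq_iff)
    then show "g' = snd D"
      using vector_eq_ldot by blast
  qed
qed

definition viscosity_solution ::
  "real \<Rightarrow> real \<Rightarrow> real \<Rightarrow>
   (real \<Rightarrow> real^'n \<Rightarrow> (real \<Rightarrow> real^'n) \<Rightarrow> real^'n \<Rightarrow> real) \<Rightarrow>
   (real^'n \<Rightarrow> (real \<Rightarrow> real^'n) \<Rightarrow> real) \<Rightarrow>
   (real \<Rightarrow> real^'n \<Rightarrow> (real \<Rightarrow> real^'n) \<Rightarrow> real) \<Rightarrow> bool" where
  "viscosity_solution t0 \<theta> h H \<sigma> \<phi> \<longleftrightarrow>
     \<phi> \<in> Phi t0 \<theta> h \<and>
     (\<forall>z. \<forall>w\<in>PC h. \<phi> \<theta> z w = \<sigma> z w) \<and>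
     (\<forall>(\<tau>, z, w)\<in>GG t0 \<theta> h. \<tau> < \<theta> \<longrightarrow>
       (\<forall>\<psi>::real \<times> (real^'n) \<Rightarrow> real. \<forall>\<delta>>0. continuously_differentiable \<psi> \<longrightarrow>
         ((\<forall>(t, x)\<in>O_plus \<theta> \<delta> \<tau> z.
             \<phi> \<tau> z w - \<psi> (\<tau>, z) \<le> \<phi> t x (segment h t (const_ext \<tau> z w)) - \<psi> (t, x)) \<longrightarrow>
           partial_t \<psi> \<tau> z + H \<tau> z w (grad_z \<psi> \<tau> z) \<le> 0) \<and>
         ((\<forall>(t, x)\<in>O_plus \<theta> \<delta> \<tau> z.
             \<phi> \<tau> z w - \<psi> (\<tau>, z) \<ge> \<phi> t x (segment h t (const_ext \<tau> z w)) - \<psi> (t, x)) \<longrightarrow>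
           partial_t \<psi> \<tau> z + H \<tau> z w (grad_z \<psi> \<tau> z) \<ge> 0)))"

definition diff_quot ::
  "real \<Rightarrow> (real \<Rightarrow> real^'n \<Rightarrow> (real \<Rightarrow> real^'n) \<Rightarrow> real) \<Rightarrow>
   real \<Rightarrow> real^'n \<Rightarrow> (real \<Rightarrow> real^'n) \<Rightarrow> real \<Rightarrow> real^'n \<Rightarrow> real \<Rightarrow> real^'n \<Rightarrow> real" where
  "diff_quot h \<phi> \<tau> z w p0 p t x =
     (\<phi> t x (segment h t (const_ext \<tau> z w)) - \<phi> \<tau> z w - (t - \<tau>) * p0 - (x - z) \<bullet> p)
       / (\<bar>t - \<tau>\<bar> + norm (x - z))"

text \<open>
  The infimum and supremum of the quotient may be infinite, hence are taken in \<open>ereal\<close>. They are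
  monotone in \<open>\<delta>\<close>, so the limits as \<open>\<delta>\<close> decreases to \<open>0\<close> always exist and are unique.
\<close>

definition D_minus ::
  "real \<Rightarrow> real \<Rightarrow> (real \<Rightarrow> real^'n \<Rightarrow> (real \<Rightarrow> real^'n) \<Rightarrow> real) \<Rightarrow>
   real \<Rightarrow> real^'n \<Rightarrow> (real \<Rightarrow> real^'n) \<Rightarrow> (real \<times> (real^'n)) set" where
  "D_minus \<theta> h \<phi> \<tau> z w = {(p0, p).
     \<exists>L::ereal. ((\<lambda>\<delta>. INF (t, x)\<in>O_plus \<theta> \<delta> \<tau> z - {(\<tau>, z)}.
        ereal (diff_quot h \<phi> \<tau> z w p0 p t x)) \<longlongrightarrow> L) (at_right 0) \<and> L \<ge> 0}"

definition D_plus ::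
  "real \<Rightarrow> real \<Rightarrow> (real \<Rightarrow> real^'n \<Rightarrow> (real \<Rightarrow> real^'n) \<Rightarrow> real) \<Rightarrow>
   real \<Rightarrow> real^'n \<Rightarrow> (real \<Rightarrow> real^'n) \<Rightarrow> (real \<times> (real^'n)) set" where
  "D_plus \<theta> h \<phi> \<tau> z w = {(q0, q).
     \<exists>L::ereal. ((\<lambda>\<delta>. SUP (t, x)\<in>O_plus \<theta> \<delta> \<tau> z - {(\<tau>, z)}.
        ereal (diff_quot h \<phi> \<tau> z w q0 q t x)) \<longlongrightarrow> L) (at_right 0) \<and> L \<le> 0}"

end

theory Submission
  imports Defs
begin

text \<open>
  Elements of \<open>D\<^sup>-\<phi>\<close> are exactly the pairs \<open>(\<partial>\<psi>, \<nabla>\<psi>)\<close> of test functions \<open>\<psi>\<close> touching \<open>\<phi>\<close> from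
  below. A touching \<open>\<psi>\<close> gives a subdifferential element by first-order expansion. Conversely,
  the negative part of the remainder \<open>\<phi> - \<phi>(\<tau>, z, w) - (t - \<tau>) p\<^sub>0 - \<langle>x - z, p\<rangle>\<close> is \<open>o(\<parallel>y\<parallel>)\<close> in
  \<open>y = (t - \<tau>, x - z)\<close>, and every such function is dominated by a \<open>C\<^sup>1\<close> function
  \<open>G(y) = \<Sum>k. 2\<^sup>-\<^sup>k (sqrt (a\<^sub>k\<^sup>2 + 3 \<parallel>y\<parallel>\<^sup>2) - a\<^sub>k)\<close> with vanishing gradient at \<open>0\<close>, where
  \<open>a\<^sub>k \<le> 2\<^sup>-\<^sup>k\<close> is such that the function is at most \<open>2\<^sup>-\<^sup>(\<^sup>k\<^sup>+\<^sup>1\<^sup>) \<parallel>y\<parallel>\<close> for \<open>\<parallel>y\<parallel> < a\<^sub>k\<close>: the \<open>k\<close>-th square root term is at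
  least \<open>\<parallel>y\<parallel>\<close> as soon as \<open>\<parallel>y\<parallel> \<ge> a\<^sub>k\<close>. The superdifferential is treated by passing to \<open>-\<phi>\<close>.
\<close>

section \<open>Smooth majorants of little-o functions\<close>

lemma hyperboloid_gderiv:
  fixes y :: "'a::real_inner"
  assumes "a > 0"
  shows "GDERIV (\<lambda>y. sqrt (a\<^sup>2 + 3 * (norm y)\<^sup>2) - a) y :> (3 / sqrt (a\<^sup>2 + 3 * (norm y)\<^sup>2)) *\<^sub>R y"
proof -
  have pos: "a\<^sup>2 + 3 * (y \<bullet> y) > 0"
    using assms by (simp add: add_pos_nonneg)
  show ?thesis
    unfolding gderiv_def power2_norm_eq_inner
    using pos
    by (auto intro!: derivative_eq_intros simp: fun_eq_iff inner_commute field_simps)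
qed

text \<open>The root in the denominator is at least \<open>norm y\<close>, so the gradient is
  bounded by a constant that depends neither on \<open>a\<close> nor on \<open>y\<close>. This
  uniformity is what lets the weighted gradients be summed for an arbitrary choice of the
  parameters.\<close>

lemma hyperboloid_gradient_bound:
  fixes y :: "'a::real_inner"
  assumes "a > 0"
  shows "norm ((3 / sqrt (a\<^sup>2 + 3 * (norm y)\<^sup>2)) *\<^sub>R y) \<le> 3"
proof -
  have "norm y \<le> sqrt (a\<^sup>2 + 3 * (norm y)\<^sup>2)"
    by (rule real_le_rsqrt) auto
  moreover have "sqrt (a\<^sup>2 + 3 * (norm y)\<^sup>2) > 0"
    using assms by (simp add: add_pos_nonneg)
  ultimately show ?thesis
    by (simp add: divide_simps)
qed

text \<open>Squaring \<open>r + a\<close> produces \<open>r\<^sup>2 + 2*a*r + a\<^sup>2\<close>, and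
  \<open>a \<le> r\<close> absorbs the mixed term into \<open>2*r\<^sup>2\<close>. This is where the
  factor 3 under the root comes from.\<close>

lemma hyperboloid_ge:
  fixes r a :: real
  assumes "a > 0" "a \<le> r"
  shows "r \<le> sqrt (a\<^sup>2 + 3 * r\<^sup>2) - a"
proof -
  have "a * r \<le> r * r"
    using assms by (intro mult_right_mono) auto
  then have "(r + a)\<^sup>2 \<le> a\<^sup>2 + 3 * r\<^sup>2"
    by (simp add: power2_eq_square algebra_simps)
  from real_le_rsqrt[OF this] show ?thesis
    by simp
qed

text \<open>The M-test gives uniform convergence of the gradients on the whole space, and the series
  itself converges at 0 because every term vanishes there. Termwise differentiation then applies,
  and the gradient of the sum is continuous as a uniform limit of continuous functions.\<close>

lemma gderiv_suminf:
  fixes g :: "nat \<Rightarrow> 'a::{real_inner, banach} \<Rightarrow> real" and D :: "nat \<Rightarrow> 'a \<Rightarrow> 'a"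
  assumes deriv: "\<And>k y. GDERIV (g k) y :> D k y"
    and cont: "\<And>k. continuous_on UNIV (D k)"
    and bound: "\<And>k y. norm (D k y) \<le> M k"
    and M: "summable M"
    and zero: "\<And>k. g k 0 = 0"
  shows "\<And>y. summable (\<lambda>k. g k y)"
    and "\<And>y. GDERIV (\<lambda>y. \<Sum>k. g k y) y :> (\<Sum>k. D k y)"
    and "continuous_on UNIV (\<lambda>y. \<Sum>k. D k y)"
proof -
  have unif: "uniform_limit UNIV (\<lambda>n y. \<Sum>k<n. D k y) (\<lambda>y. \<Sum>k. D k y) sequentially"
    by (rule Weierstrass_m_test) (use bound M in auto)
  have "\<forall>\<^sub>F n in sequentially. \<forall>y\<in>UNIV. \<forall>v.
      norm ((\<Sum>k<n. v \<bullet> D k y) - v \<bullet> (\<Sum>k. D k y)) \<le> e * norm v" if "e > 0" for e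
    using uniform_limitD[OF unif \<open>e > 0\<close>]
  proof eventually_elim
    case (elim n)
    show ?case
    proof (intro ballI allI)
      fix y v
      \<comment> \<open>\<open>has_derivative_series\<close> needs the derivatives to converge
        uniformly as linear maps. Cauchy-Schwarz bounds the operator norm of the difference by the
        distance of the gradients.\<close>
      have "(\<Sum>k<n. v \<bullet> D k y) - v \<bullet> (\<Sum>k. D k y) = v \<bullet> ((\<Sum>k<n. D k y) - (\<Sum>k. D k y))"
        by (simp add: inner_sum_right inner_diff_right)
      also have "norm \<dots> \<le> norm v * norm ((\<Sum>k<n. D k y) - (\<Sum>k. D k y))"
        by (metis Cauchy_Schwarz_ineq2 real_norm_def)
      also have "\<dots> \<le> norm v * e"
        using elim by (intro mult_left_mono) (auto simp: dist_norm less_imp_le)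
      finally show "norm ((\<Sum>k<n. v \<bullet> D k y) - v \<bullet> (\<Sum>k. D k y)) \<le> e * norm v"
        by (simp add: mult.commute)
    qed
  qed
  moreover have "(\<lambda>k. g k 0) sums 0"
    by (simp add: zero)
  ultimately have "\<exists>G. \<forall>y\<in>UNIV. (\<lambda>k. g k y) sums G y \<and>
      (G has_derivative (\<lambda>v. v \<bullet> (\<Sum>k. D k y))) (at y)"
    using deriv by (intro has_derivative_series) (auto simp: gderiv_def)
  then obtain G where G: "\<And>y. (\<lambda>k. g k y) sums G y"
      "\<And>y. (G has_derivative (\<lambda>v. v \<bullet> (\<Sum>k. D k y))) (at y)"
    by blast
  have G_eq: "G = (\<lambda>y. \<Sum>k. g k y)"
    using G(1) by (auto simp: sums_iff)
  show "\<And>y. summable (\<lambda>k. g k y)"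
    using G(1) by (auto simp: sums_iff)
  show "\<And>y. GDERIV (\<lambda>y. \<Sum>k. g k y) y :> (\<Sum>k. D k y)"
    using G(2) by (simp add: G_eq gderiv_def)
  show "continuous_on UNIV (\<lambda>y. \<Sum>k. D k y)"
    by (rule uniform_limit_theorem[OF _ unif]) (auto intro!: always_eventually continuous_on_sum cont)
qed

text \<open>The bound on \<open>R\<close> is one-sided and confined to \<open>S\<close>, with no
  regularity asked of \<open>R\<close>, so that the result applies to the remainder of a
  subdifferential element. The majorant \<open>G\<close> nevertheless is differentiable on the whole
  space.\<close>

lemma C1_majorant_of_little_o:
  fixes R :: "'a::{real_inner, banach} \<Rightarrow> real"
  assumes little_o: "\<And>\<epsilon>. \<epsilon> > 0 \<Longrightarrow> \<exists>a>0. \<forall>y\<in>S. norm y < a \<longrightarrow> R y \<le> \<epsilon> * norm y"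
  obtains G D \<delta> where "continuous_on UNIV D" "\<And>y. GDERIV G y :> D y" "G 0 = 0" "D 0 = 0"
    "\<delta> > 0" "\<And>y. y \<in> S \<Longrightarrow> norm y < \<delta> \<Longrightarrow> R y \<le> G y"
proof -
  \<comment> \<open>Capping the threshold by \<open>(1/2)^k\<close> makes the thresholds tend to 0,
    so every nonzero \<open>y\<close> eventually lies beyond one of them.\<close>
  have "\<exists>a>0. a \<le> (1/2)^k \<and> (\<forall>y\<in>S. norm y < a \<longrightarrow> R y \<le> (1/2)^Suc k * norm y)" for k :: nat
  proof -
    obtain a where "a > 0" "\<forall>y\<in>S. norm y < a \<longrightarrow> R y \<le> (1/2)^Suc k * norm y"
      using little_o[of "(1/2)^Suc k"] by auto
    then show ?thesis
      by (intro exI[of _ "min a ((1/2)^k)"]) auto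
  qed
  then obtain a :: "nat \<Rightarrow> real" where a: "\<And>k. a k > 0" "\<And>k. a k \<le> (1/2)^k"
      "\<And>k y. y \<in> S \<Longrightarrow> norm y < a k \<Longrightarrow> R y \<le> (1/2)^Suc k * norm y"
    by metis
  define g where "g k y = (1/2)^k * (sqrt ((a k)\<^sup>2 + 3 * (norm y)\<^sup>2) - a k)" for k and y :: 'a
  define D where "D k y = (1/2)^k *\<^sub>R ((3 / sqrt ((a k)\<^sup>2 + 3 * (norm y)\<^sup>2)) *\<^sub>R y)" for k and y :: 'a
  have deriv: "GDERIV (g k) y :> D k y" for k y
  proof -
    have "((\<lambda>y. sqrt ((a k)\<^sup>2 + 3 * (norm y)\<^sup>2) - a k) has_derivative
        (\<lambda>v. v \<bullet> ((3 / sqrt ((a k)\<^sup>2 + 3 * (norm y)\<^sup>2)) *\<^sub>R y))) (at y)"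
      using hyperboloid_gderiv[OF a(1)] by (simp only: gderiv_def)
    from has_derivative_mult_right[OF this, of "(1/2)^k"] show ?thesis
      by (simp add: gderiv_def g_def[abs_def] D_def mult.assoc)
  qed
  have ne: "sqrt ((a k)\<^sup>2 + 3 * (norm y)\<^sup>2) \<noteq> 0" for k and y :: 'a
    using a(1)[of k] by (smt (verit) real_sqrt_gt_zero zero_less_power zero_le_power2)
  have cont: "continuous_on UNIV (D k)" for k
    unfolding D_def by (intro continuous_intros ballI ne)
  have bound: "norm (D k y) \<le> (1/2)^k * 3" for k y
    unfolding D_def norm_scaleR[of "(1/2)^k"]
    using hyperboloid_gradient_bound[OF a(1)[of k], of y]
    by (intro mult_mono) auto
  have zero: "g k 0 = 0" for k
    using a(1)[of k] by (simp add: g_def)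
  have M: "summable (\<lambda>k. (1/2)^k * 3 :: real)"
    by (intro summable_mult2 summable_geometric) auto
  note series = gderiv_suminf[OF deriv cont bound M zero]
  show ?thesis
  proof (rule that)
    show "continuous_on UNIV (\<lambda>y. \<Sum>k. D k y)" "\<And>y. GDERIV (\<lambda>y. \<Sum>k. g k y) y :> (\<Sum>k. D k y)"
      using series by auto
    show "(\<Sum>k. g k 0) = 0" "(\<Sum>k. D k 0) = 0"
      by (simp_all add: zero D_def)
    show "a 0 > 0"
      by (rule a)
    fix y assume y: "y \<in> S" "norm y < a 0"
    have g_nonneg: "g k y \<ge> 0" for k
      using a(1)[of k] by (auto simp: g_def intro!: mult_nonneg_nonneg real_le_rsqrt)
    show "R y \<le> (\<Sum>k. g k y)"
    proof (cases "y = 0")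
      \<comment> \<open>At the origin the little-o bound itself forces
        \<open>R 0 \<le> 0\<close>.\<close>
      case True
      then show ?thesis
        using a(3)[OF y] by (simp add: zero)
    next
      case False
      then obtain k where "(1/2)^k < norm y"
        using real_arch_pow_inv[of "norm y" "1/2"] by auto
      then have k: "a k \<le> norm y"
        using a(2)[of k] by simp
      \<comment> \<open>The sequence \<open>a\<close> need not be monotone, so the first threshold
        not exceeding \<open>norm y\<close> is taken. Since \<open>norm y < a 0\<close>, it has a
        predecessor \<open>j\<close>, whose threshold still exceeds \<open>norm y\<close>. The
        accuracy \<open>(1/2)^Suc j\<close> granted there equals the weight \<open>(1/2)^m\<close>
        of the \<open>m\<close>-th term, so this single term already dominates
        \<open>R y\<close>.\<close>
      define m where "m = (LEAST k. a k \<le> norm y)"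
      have m: "a m \<le> norm y"
        unfolding m_def by (rule LeastI, rule k)
      with y have "m \<noteq> 0"
        by (metis not_less)
      then obtain j where j: "m = Suc j"
        using not0_implies_Suc by blast
      have "norm y < a j"
        using not_less_Least[of j "\<lambda>k. a k \<le> norm y"] j by (simp add: m_def)
      then have "R y \<le> (1/2)^m * norm y"
        using a(3) y j by simp
      also have "\<dots> \<le> g m y"
        unfolding g_def using hyperboloid_ge[OF a(1) m] by (intro mult_left_mono) auto
      also have "\<dots> \<le> (\<Sum>k. g k y)"
        using sum_le_suminf[OF series(1), of "{m}" y] g_nonneg by simp
      finally show ?thesis .
    qed
  qed
qed

section \<open>Epsilon-delta form of the subdifferential and duality with the
  superdifferential\<close>

text \<open>Infima over shrinking sets increase as \<delta> decreases, so they converge in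
  \<open>ereal\<close> to their supremum. That supremum is nonnegative exactly when each negative
  real is a lower bound of \<open>q\<close> on some \<open>A d\<close>.\<close>

lemma INF_limit_nonneg_iff:
  fixes A :: "real \<Rightarrow> 'b set" and q :: "'b \<Rightarrow> real"
  assumes mono: "\<And>d e. 0 < d \<Longrightarrow> d \<le> e \<Longrightarrow> A d \<subseteq> A e"
  shows "(\<exists>L::ereal. ((\<lambda>\<delta>. INF y\<in>A \<delta>. ereal (q y)) \<longlongrightarrow> L) (at_right 0) \<and> L \<ge> 0) \<longleftrightarrow>
    (\<forall>\<epsilon>>0. \<exists>d>0. \<forall>y\<in>A d. - \<epsilon> \<le> q y)"
proof (intro iffI allI impI)
  fix \<epsilon> :: real
  assume "\<exists>L::ereal. ((\<lambda>\<delta>. INF y\<in>A \<delta>. ereal (q y)) \<longlongrightarrow> L) (at_right 0) \<and> L \<ge> 0" and "\<epsilon> > 0"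
  then obtain L :: ereal where L: "((\<lambda>\<delta>. INF y\<in>A \<delta>. ereal (q y)) \<longlongrightarrow> L) (at_right 0)" "L \<ge> 0"
    by blast
  have "ereal (- \<epsilon>) < L"
    using \<open>\<epsilon> > 0\<close> L(2) by (intro less_le_trans[OF _ L(2)]) auto
  from order_tendstoD(1)[OF L(1) this]
  obtain b where b: "b > 0" "\<And>d. d > 0 \<Longrightarrow> d < b \<Longrightarrow> ereal (- \<epsilon>) < (INF y\<in>A d. ereal (q y))"
    by (auto simp: eventually_at_right_field)
  have "- \<epsilon> \<le> q y" if "y \<in> A (b/2)" for y
    using less_le_trans[OF b(2)[of "b/2"] INF_lower[OF that]] b(1) by simp
  then show "\<exists>d>0. \<forall>y\<in>A d. - \<epsilon> \<le> q y"
    using b(1) by (intro exI[of _ "b/2"]) auto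
next
  assume *: "\<forall>\<epsilon>>0. \<exists>d>0. \<forall>y\<in>A d. - \<epsilon> \<le> q y"
  define F where "F \<delta> = (INF y\<in>A \<delta>. ereal (q y))" for \<delta>
  \<comment> \<open>By monotonicity the limit at \<open>0\<close> from the right is the supremum
    over all positive radii.\<close>
  define L where "L = (SUP \<delta>\<in>{0<..}. F \<delta>)"
  have le: "F \<delta> \<le> L" if "\<delta> > 0" for \<delta>
    unfolding L_def by (rule SUP_upper) (use that in auto)
  have "(F \<longlongrightarrow> L) (at_right 0)"
  proof (rule order_tendstoI)
    fix c assume "c < L"
    then obtain e where e: "e > 0" "c < F e"
      by (auto simp: L_def less_SUP_iff)
    have "c < F d" if "0 < d" "d < e" for d
      using e(2) INF_superset_mono[OF mono[of d e], of "\<lambda>y. ereal (q y)"] that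
      by (auto simp: F_def intro: less_le_trans)
    then show "\<forall>\<^sub>F d in at_right 0. c < F d"
      using e(1) by (auto simp: eventually_at_right_field)
  next
    fix c assume "L < c"
    then show "\<forall>\<^sub>F d in at_right 0. F d < c"
      using le by (auto simp: eventually_at_right_field intro!: exI[of _ 1] intro: le_less_trans)
  qed
  \<comment> \<open>If \<open>L\<close> were negative, a real \<open>c\<close> strictly between
    \<open>L\<close> and 0 would give \<epsilon> \<open>= - c\<close> and a radius \<open>d\<close>
    with \<open>c \<le> F d \<le> L\<close>.\<close>
  moreover have "L \<ge> 0"
  proof (rule ccontr)
    assume "\<not> L \<ge> 0"
    then obtain c where c: "L < ereal c" "ereal c < 0"
      using ereal_dense2[of L 0] by (auto simp: not_le)
    then obtain d where d: "d > 0" "\<And>y. y \<in> A d \<Longrightarrow> c \<le> q y"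
      using *[rule_format, of "- c"] by auto
    then have "ereal c \<le> F d"
      by (auto simp: F_def intro!: INF_greatest)
    with le[OF d(1)] c(1) show False
      by simp
  qed
  ultimately show "\<exists>L::ereal. ((\<lambda>\<delta>. INF y\<in>A \<delta>. ereal (q y)) \<longlongrightarrow> L) (at_right 0) \<and> L \<ge> 0"
    by (auto simp: F_def[abs_def])
qed

lemma O_plus_mono: "d \<le> e \<Longrightarrow> O_plus \<theta> d \<tau> z \<subseteq> O_plus \<theta> e \<tau> z"
  by (auto simp: O_plus_def)

text \<open>For \<xi> \<open>< 0\<close> the extension is evaluated before \<tau>, where it reads
  off \<open>w\<close>. Outside the interval both sides are \<open>undefined\<close>, since
  \<open>w\<close> is extensional.\<close>

lemma segment_const_ext:
  assumes "w \<in> PC h"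
  shows "segment h \<tau> (const_ext \<tau> z w) = w"
  using assms by (auto simp: segment_def const_ext_def PC_def extensional_def restrict_def)

text \<open>Away from \<open>(\<tau>, z)\<close> the denominator is positive and can be multiplied
  out. The resulting inequality also holds at \<open>(\<tau>, z)\<close>, where both sides vanish,
  so the exclusion of that point disappears.\<close>

lemma D_minus_iff:
  fixes z :: "real^'n"
  assumes "w \<in> PC h"
  shows "(p0, p) \<in> D_minus \<theta> h \<phi> \<tau> z w \<longleftrightarrow>
    (\<forall>\<epsilon>>0. \<exists>d>0. \<forall>(t, x)\<in>O_plus \<theta> d \<tau> z.
       - \<epsilon> * (\<bar>t - \<tau>\<bar> + norm (x - z)) \<le>
         \<phi> t x (segment h t (const_ext \<tau> z w)) - \<phi> \<tau> z w - (t - \<tau>) * p0 - (x - z) \<bullet> p)"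
    (is "_ \<longleftrightarrow> (\<forall>\<epsilon>>0. \<exists>d>0. \<forall>(t, x)\<in>_. ?lower \<epsilon> t x)")
proof -
  have quot: "- \<epsilon> \<le> diff_quot h \<phi> \<tau> z w p0 p t x \<longleftrightarrow> ?lower \<epsilon> t x"
    if "(t, x) \<noteq> (\<tau>, z)" for \<epsilon> t x
  proof -
    have "\<bar>t - \<tau>\<bar> + norm (x - z) > 0"
      using that by (auto simp: add_pos_nonneg add_nonneg_pos)
    then show ?thesis
      by (simp add: diff_quot_def pos_le_divide_eq)
  qed
  have centre: "?lower \<epsilon> \<tau> z" for \<epsilon>
    using assms by (simp add: segment_const_ext)
  have "(p0, p) \<in> D_minus \<theta> h \<phi> \<tau> z w \<longleftrightarrow>
      (\<forall>\<epsilon>>0. \<exists>d>0. \<forall>y\<in>O_plus \<theta> d \<tau> z - {(\<tau>, z)}. - \<epsilon> \<le> (case y of (t, x) \<Rightarrow> diff_quot h \<phi> \<tau> z w p0 p t x))"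
  proof -
    have "O_plus \<theta> d \<tau> z - {(\<tau>, z)} \<subseteq> O_plus \<theta> e \<tau> z - {(\<tau>, z)}" if "0 < d" "d \<le> e" for d e
      using O_plus_mono[OF that(2)] by fast
    from INF_limit_nonneg_iff[where A = "\<lambda>d. O_plus \<theta> d \<tau> z - {(\<tau>, z)}"
        and q = "\<lambda>y. diff_quot h \<phi> \<tau> z w p0 p (fst y) (snd y)", OF this]
    show ?thesis
      unfolding D_minus_def case_prod_unfold mem_Collect_eq fst_conv snd_conv .
  qed
  also have "\<dots> \<longleftrightarrow> (\<forall>\<epsilon>>0. \<exists>d>0. \<forall>(t, x)\<in>O_plus \<theta> d \<tau> z. ?lower \<epsilon> t x)"
  proof -
    have "(\<forall>y\<in>O_plus \<theta> d \<tau> z - {(\<tau>, z)}. - \<epsilon> \<le> (case y of (t, x) \<Rightarrow> diff_quot h \<phi> \<tau> z w p0 p t x)) \<longleftrightarrow>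
        (\<forall>(t, x)\<in>O_plus \<theta> d \<tau> z. ?lower \<epsilon> t x)" for \<epsilon> d
      unfolding Ball_def split_paired_All case_prod_conv Diff_iff singleton_iff
      using quot[of _ _ \<epsilon>] centre[of \<epsilon>] by (metis Pair_inject)
    then show ?thesis
      by simp
  qed
  finally show ?thesis .
qed

text \<open>Negating the functional and the slopes flips the sign of the quotient, which exchanges
  supremum and infimum. Negation on \<open>ereal\<close> preserves convergence and reverses the
  order.\<close>

lemma D_plus_uminus:
  "(q0, q) \<in> D_plus \<theta> h \<phi> \<tau> z w \<longleftrightarrow> (- q0, - q) \<in> D_minus \<theta> h (\<lambda>t x r. - \<phi> t x r) \<tau> z w"
proof -
  have neg: "diff_quot h (\<lambda>t x r. - \<phi> t x r) \<tau> z w (- q0) (- q) t x = - diff_quot h \<phi> \<tau> z w q0 q t x"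
    for t x
    unfolding diff_quot_def minus_divide_left by simp
  let ?S = "\<lambda>\<delta>. SUP (t, x)\<in>O_plus \<theta> \<delta> \<tau> z - {(\<tau>, z)}. ereal (diff_quot h \<phi> \<tau> z w q0 q t x)"
  have inf: "(INF (t, x)\<in>O_plus \<theta> \<delta> \<tau> z - {(\<tau>, z)}.
      ereal (diff_quot h (\<lambda>t x r. - \<phi> t x r) \<tau> z w (- q0) (- q) t x)) = - ?S \<delta>" for \<delta>
    unfolding neg case_prod_unfold uminus_ereal.simps(1)[symmetric] by (rule ereal_INF_uminus_eq)
  have "(\<exists>L. (?S \<longlongrightarrow> L) (at_right 0) \<and> L \<le> 0) \<longleftrightarrow>
      (\<exists>L. ((\<lambda>\<delta>. - ?S \<delta>) \<longlongrightarrow> L) (at_right 0) \<and> L \<ge> 0)"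
  proof
    assume "\<exists>L. (?S \<longlongrightarrow> L) (at_right 0) \<and> L \<le> 0"
    then obtain L where "(?S \<longlongrightarrow> L) (at_right 0)" "L \<le> 0"
      by blast
    then show "\<exists>L. ((\<lambda>\<delta>. - ?S \<delta>) \<longlongrightarrow> L) (at_right 0) \<and> L \<ge> 0"
      by (intro exI[of _ "- L"] conjI tendsto_uminus_ereal) auto
  next
    assume "\<exists>L. ((\<lambda>\<delta>. - ?S \<delta>) \<longlongrightarrow> L) (at_right 0) \<and> L \<ge> 0"
    then obtain L where L: "((\<lambda>\<delta>. - ?S \<delta>) \<longlongrightarrow> L) (at_right 0)" "L \<ge> 0"
      by blast
    from tendsto_uminus_ereal[OF L(1)] L(2)
    show "\<exists>L. (?S \<longlongrightarrow> L) (at_right 0) \<and> L \<le> 0"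
      by (intro exI[of _ "- L"] conjI) auto
  qed
  then show ?thesis
    by (simp add: D_plus_def D_minus_def inf)
qed

section \<open>Subdifferential elements as derivatives of test functions\<close>

text \<open>Only differences enter, so \<psi> lies below \<phi> up to an additive constant. Applied
  to the negatives of \<phi> and \<psi>, the same predicate expresses touching from above.\<close>

definition touches_below ::
  "real \<Rightarrow> real \<Rightarrow> (real \<Rightarrow> real^'n \<Rightarrow> (real \<Rightarrow> real^'n) \<Rightarrow> real) \<Rightarrow>
   real \<Rightarrow> real^'n \<Rightarrow> (real \<Rightarrow> real^'n) \<Rightarrow> real \<Rightarrow> (real \<times> (real^'n) \<Rightarrow> real) \<Rightarrow> bool" where
  "touches_below \<theta> h \<phi> \<tau> z w \<delta> \<psi> \<longleftrightarrow> (\<forall>(t, x)\<in>O_plus \<theta> \<delta> \<tau> z.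
     \<phi> \<tau> z w - \<psi> (\<tau>, z) \<le> \<phi> t x (segment h t (const_ext \<tau> z w)) - \<psi> (t, x))"

text \<open>The test function is the linear part with slopes \<open>(p0, p)\<close> minus a smooth
  majorant of the negated remainder. As the gradient of the majorant vanishes at 0, the slopes at
  the base point are unchanged.\<close>

lemma D_minus_imp_test_function:
  fixes z :: "real^'n"
  assumes w: "w \<in> PC h" and p: "(p0, p) \<in> D_minus \<theta> h \<phi> \<tau> z w"
  obtains \<psi> \<delta> where "continuously_differentiable \<psi>" "partial_t \<psi> \<tau> z = p0" "grad_z \<psi> \<tau> z = p"
    "\<delta> > 0" "touches_below \<theta> h \<phi> \<tau> z w \<delta> \<psi>"
proof -
  define E where "E y = \<phi> (\<tau> + fst y) (z + snd y) (segment h (\<tau> + fst y) (const_ext \<tau> z w))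
      - \<phi> \<tau> z w - y \<bullet> (p0, p)" for y :: "real \<times> (real^'n)"
  \<comment> \<open>These are the increments whose time part goes forward and stays within the
    horizon, the only ones that \<open>O_plus\<close> admits.\<close>
  define S where "S = {y :: real \<times> (real^'n). 0 \<le> fst y \<and> \<tau> + fst y \<le> \<theta>}"
  have little_o: "\<exists>a>0. \<forall>y\<in>S. norm y < a \<longrightarrow> - E y \<le> \<epsilon> * norm y" if "\<epsilon> > 0" for \<epsilon>
  proof -
    \<comment> \<open>Half of \<epsilon> is used because the sum of the norms of the two components
      of \<open>y\<close> is at most \<open>2 * norm y\<close>.\<close>
    obtain d where d: "d > 0" "\<And>t x. (t, x) \<in> O_plus \<theta> d \<tau> z \<Longrightarrow>
        - (\<epsilon> / 2) * (\<bar>t - \<tau>\<bar> + norm (x - z)) \<le>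
          \<phi> t x (segment h t (const_ext \<tau> z w)) - \<phi> \<tau> z w - (t - \<tau>) * p0 - (x - z) \<bullet> p"
      using p[unfolded D_minus_iff[OF w]] \<open>\<epsilon> > 0\<close> half_gt_zero[OF \<open>\<epsilon> > 0\<close>] by fast
    have "- E y \<le> \<epsilon> * norm y" if "y \<in> S" "norm y < d" for y
    proof -
      obtain s v where y: "y = (s, v)"
        by fastforce
      have le: "\<bar>s\<bar> \<le> norm y" "norm v \<le> norm y"
        using norm_fst_le[of s v] norm_snd_le[of v s] by (auto simp: y)
      have "(\<tau> + s, z + v) \<in> O_plus \<theta> d \<tau> z"
        using that le by (auto simp: O_plus_def S_def y)
      from d(2)[OF this] have "- E y \<le> \<epsilon> / 2 * (\<bar>s\<bar> + norm v)"
        by (simp add: E_def y)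
      also have "\<dots> \<le> \<epsilon> / 2 * (2 * norm y)"
        using le \<open>\<epsilon> > 0\<close> by (intro mult_left_mono) auto
      finally show ?thesis
        by simp
    qed
    with d(1) show ?thesis
      by blast
  qed
  obtain G D \<delta> where G: "continuous_on UNIV D" "\<And>y. GDERIV G y :> D y" "G 0 = 0" "D 0 = 0"
      "\<delta> > 0" "\<And>y. y \<in> S \<Longrightarrow> norm y < \<delta> \<Longrightarrow> - E y \<le> G y"
    by (rule C1_majorant_of_little_o[of S "\<lambda>y. - E y", OF little_o]) (assumption, rule that)
  define \<psi> where "\<psi> y = (y - (\<tau>, z)) \<bullet> (p0, p) - G (y - (\<tau>, z))" for y
  have deriv: "GDERIV \<psi> y :> (p0, p) - D (y - (\<tau>, z))" for y
  proof -
    have "((\<lambda>y. G (y - (\<tau>, z))) has_derivative (\<lambda>v. v \<bullet> D (y - (\<tau>, z)))) (at y)"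
      by (rule has_derivative_compose[where g = G and f = "\<lambda>y. y - (\<tau>, z)"])
         (use G(2) in \<open>auto intro!: derivative_eq_intros simp: gderiv_def\<close>)
    then show ?thesis
      unfolding gderiv_def \<psi>_def[abs_def]
      by (auto intro!: derivative_eq_intros simp: fun_eq_iff inner_diff_right)
  qed
  show ?thesis
  proof (rule that)
    have "continuous_on UNIV (\<lambda>y. (p0, p) - D (y - (\<tau>, z)))"
      by (intro continuous_intros continuous_on_compose2[OF G(1)]) auto
    with deriv show "continuously_differentiable \<psi>"
      unfolding continuously_differentiable_def
      by (intro exI[of _ "\<lambda>y. (p0, p) - D (y - (\<tau>, z))"]) simp
    have "GDERIV \<psi> (\<tau>, z) :> (p0, p)"
      using deriv[of "(\<tau>, z)"] G(4) by (simp add: zero_prod_def)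
    from gderiv_components[OF this] show "partial_t \<psi> \<tau> z = p0" "grad_z \<psi> \<tau> z = p"
      by simp_all
    \<comment> \<open>\<open>O_plus\<close> bounds both components of the increment by the radius,
      so the norm is at most \<open>2 * \<delta> / 3\<close>. This is strictly below \<delta>, as
      the majorant requires.\<close>
    show "\<delta> / 3 > 0"
      using G(5) by simp
    show "touches_below \<theta> h \<phi> \<tau> z w (\<delta> / 3) \<psi>"
      unfolding touches_below_def
    proof clarify
      fix t x assume tx: "(t, x) \<in> O_plus \<theta> (\<delta> / 3) \<tau> z"
      have "norm (t - \<tau>, x - z) \<le> \<bar>t - \<tau>\<bar> + norm (x - z)"
        using norm_Pair_le[of "t - \<tau>" "x - z"] by simp
      also have "\<dots> < \<delta>"
        using tx G(5) by (auto simp: O_plus_def)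
      finally have "- E (t - \<tau>, x - z) \<le> G (t - \<tau>, x - z)"
        using tx by (intro G(6)) (auto simp: S_def O_plus_def)
      then show "\<phi> \<tau> z w - \<psi> (\<tau>, z) \<le> \<phi> t x (segment h t (const_ext \<tau> z w)) - \<psi> (t, x)"
        using G(3) by (simp add: \<psi>_def E_def zero_prod_def)
    qed
  qed
qed

text \<open>Touching bounds the increment of \<phi> below by that of \<psi>, and the first-order
  expansion of \<psi> bounds the latter below by its linear part up to \<epsilon> times the
  norm.\<close>

lemma test_function_imp_D_minus:
  fixes z :: "real^'n"
  assumes w: "w \<in> PC h" and \<psi>: "continuously_differentiable \<psi>"
    and \<delta>: "\<delta> > 0" "touches_below \<theta> h \<phi> \<tau> z w \<delta> \<psi>"
  shows "(partial_t \<psi> \<tau> z, grad_z \<psi> \<tau> z) \<in> D_minus \<theta> h \<phi> \<tau> z w"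
proof -
  obtain D where D: "GDERIV \<psi> (\<tau>, z) :> D"
    using \<psi> unfolding continuously_differentiable_def by blast
  show ?thesis
    unfolding D_minus_iff[OF w] gderiv_components[OF D]
  proof (intro allI impI)
    fix \<epsilon> :: real assume "\<epsilon> > 0"
    then obtain d where d: "d > 0" "\<And>y. norm (y - (\<tau>, z)) < d \<Longrightarrow>
        \<bar>\<psi> y - \<psi> (\<tau>, z) - (y - (\<tau>, z)) \<bullet> D\<bar> \<le> \<epsilon> * norm (y - (\<tau>, z))"
      using D unfolding gderiv_def has_derivative_at_alt real_norm_def by blast
    show "\<exists>d>0. \<forall>(t, x)\<in>O_plus \<theta> d \<tau> z. - \<epsilon> * (\<bar>t - \<tau>\<bar> + norm (x - z)) \<le>
        \<phi> t x (segment h t (const_ext \<tau> z w)) - \<phi> \<tau> z w - (t - \<tau>) * fst D - (x - z) \<bullet> snd D"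
    proof (intro exI conjI, safe)
      \<comment> \<open>The first radius keeps the touching inequality available, the second puts
        the increment inside the ball where the expansion holds.\<close>
      show "min \<delta> (d / 3) > 0"
        using d(1) \<delta>(1) by simp
      fix t x assume tx: "(t, x) \<in> O_plus \<theta> (min \<delta> (d / 3)) \<tau> z"
      have norm_le: "norm ((t, x) - (\<tau>, z)) \<le> \<bar>t - \<tau>\<bar> + norm (x - z)"
        using norm_Pair_le[of "t - \<tau>" "x - z"] by simp
      also have "\<dots> < d"
        using tx d(1) by (auto simp: O_plus_def)
      finally have "\<bar>\<psi> (t, x) - \<psi> (\<tau>, z) - ((t, x) - (\<tau>, z)) \<bullet> D\<bar> \<le> \<epsilon> * norm ((t, x) - (\<tau>, z))"
        by (rule d(2))
      also have "\<dots> \<le> \<epsilon> * (\<bar>t - \<tau>\<bar> + norm (x - z))"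
        using norm_le \<open>\<epsilon> > 0\<close> by (intro mult_left_mono) auto
      finally have "\<bar>\<psi> (t, x) - \<psi> (\<tau>, z) - (t - \<tau>) * fst D - (x - z) \<bullet> snd D\<bar>
          \<le> \<epsilon> * (\<bar>t - \<tau>\<bar> + norm (x - z))"
        by (simp add: inner_prod_def algebra_simps)
      moreover have "(t, x) \<in> O_plus \<theta> \<delta> \<tau> z"
        using tx O_plus_mono[of "min \<delta> (d / 3)" \<delta>] by auto
      with \<delta>(2) have "\<phi> \<tau> z w - \<psi> (\<tau>, z) \<le> \<phi> t x (segment h t (const_ext \<tau> z w)) - \<psi> (t, x)"
        by (auto simp: touches_below_def)
      ultimately show "- \<epsilon> * (\<bar>t - \<tau>\<bar> + norm (x - z)) \<le>
        \<phi> t x (segment h t (const_ext \<tau> z w)) - \<phi> \<tau> z w - (t - \<tau>) * fst D - (x - z) \<bullet> snd D"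
        by simp
    qed
  qed
qed

lemma uminus_test_function:
  assumes "continuously_differentiable \<psi>"
  shows "continuously_differentiable (\<lambda>y. - \<psi> y)"
    and "partial_t (\<lambda>y. - \<psi> y) \<tau> z = - partial_t \<psi> \<tau> z"
    and "grad_z (\<lambda>y. - \<psi> y) \<tau> z = - grad_z \<psi> \<tau> z"
proof -
  obtain D where D: "continuous_on UNIV D" "\<And>y. GDERIV \<psi> y :> D y"
    using assms by (auto simp: continuously_differentiable_def)
  have neg: "GDERIV (\<lambda>y. - \<psi> y) y :> - D y" for y
    by (rule GDERIV_minus) (rule D)
  have "continuous_on UNIV (\<lambda>y. - D y)"
    by (intro continuous_intros D)
  with neg show "continuously_differentiable (\<lambda>y. - \<psi> y)"
    unfolding continuously_differentiable_def by (intro exI[of _ "\<lambda>y. - D y"]) simp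
  show "partial_t (\<lambda>y. - \<psi> y) \<tau> z = - partial_t \<psi> \<tau> z" "grad_z (\<lambda>y. - \<psi> y) \<tau> z = - grad_z \<psi> \<tau> z"
    unfolding gderiv_components[OF D(2)[of "(\<tau>, z)"]] gderiv_components[OF neg[of "(\<tau>, z)"]]
    by simp_all
qed

lemma D_minus_characterization:
  fixes z :: "real^'n"
  assumes "w \<in> PC h"
  shows "(p0, p) \<in> D_minus \<theta> h \<phi> \<tau> z w \<longleftrightarrow>
    (\<exists>\<psi>. \<exists>\<delta>>0. continuously_differentiable \<psi> \<and> partial_t \<psi> \<tau> z = p0 \<and> grad_z \<psi> \<tau> z = p \<and>
       touches_below \<theta> h \<phi> \<tau> z w \<delta> \<psi>)"
    (is "?L \<longleftrightarrow> ?R")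
proof
  assume ?L
  then obtain \<psi> \<delta> where "continuously_differentiable \<psi>" "partial_t \<psi> \<tau> z = p0" "grad_z \<psi> \<tau> z = p"
    "\<delta> > 0" "touches_below \<theta> h \<phi> \<tau> z w \<delta> \<psi>"
    by (rule D_minus_imp_test_function[OF assms])
  then show ?R
    by (intro exI[of _ \<psi>] exI[of _ \<delta>] conjI)
next
  assume ?R
  then obtain \<psi> \<delta> where \<psi>: "\<delta> > 0" "continuously_differentiable \<psi>" "partial_t \<psi> \<tau> z = p0"
      "grad_z \<psi> \<tau> z = p" "touches_below \<theta> h \<phi> \<tau> z w \<delta> \<psi>"
    by (elim exE conjE)
  from test_function_imp_D_minus[OF assms \<psi>(2,1,5)] \<psi>(3,4) show ?L
    by simp
qed

lemma D_plus_characterization: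
  fixes z :: "real^'n"
  assumes "w \<in> PC h"
  shows "(q0, q) \<in> D_plus \<theta> h \<phi> \<tau> z w \<longleftrightarrow>
    (\<exists>\<psi>. \<exists>\<delta>>0. continuously_differentiable \<psi> \<and> partial_t \<psi> \<tau> z = q0 \<and> grad_z \<psi> \<tau> z = q \<and>
       touches_below \<theta> h (\<lambda>t x r. - \<phi> t x r) \<tau> z w \<delta> (\<lambda>y. - \<psi> y))"
    (is "_ \<longleftrightarrow> ?R")
proof
  assume "(q0, q) \<in> D_plus \<theta> h \<phi> \<tau> z w"
  then obtain \<psi> \<delta> where \<psi>: "\<delta> > 0" "continuously_differentiable \<psi>" "partial_t \<psi> \<tau> z = - q0"
      "grad_z \<psi> \<tau> z = - q" "touches_below \<theta> h (\<lambda>t x r. - \<phi> t x r) \<tau> z w \<delta> \<psi>"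
    unfolding D_plus_uminus D_minus_characterization[OF assms] by blast
  \<comment> \<open>The function obtained touches the negative of \<phi> and has slopes
    \<open>- q0\<close> and \<open>- q\<close>, so its negative is the witness.\<close>
  from \<psi>(1,3-5) uminus_test_function[OF \<psi>(2)] show ?R
    by (intro exI[of _ "\<lambda>y. - \<psi> y"] exI[of _ \<delta>] conjI) (simp_all only: minus_minus)
next
  assume ?R
  then obtain \<psi> \<delta> where \<psi>: "\<delta> > 0" "continuously_differentiable \<psi>" "partial_t \<psi> \<tau> z = q0"
      "grad_z \<psi> \<tau> z = q" "touches_below \<theta> h (\<lambda>t x r. - \<phi> t x r) \<tau> z w \<delta> (\<lambda>y. - \<psi> y)"
    by blast
  from \<psi>(1,3-5) uminus_test_function[OF \<psi>(2)] show "(q0, q) \<in> D_plus \<theta> h \<phi> \<tau> z w"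
    unfolding D_plus_uminus D_minus_characterization[OF assms]
    by (intro exI[of _ "\<lambda>y. - \<psi> y"] exI[of _ \<delta>] conjI) (simp_all only:)
qed

section \<open>Equivalence of the two notions of solution\<close>

theorem theorem2p17:
  fixes t0 \<theta> h :: real
    and U :: "(real^'l) set" and V :: "(real^'m) set"
    and f :: "real \<Rightarrow> real^'n \<Rightarrow> (real \<Rightarrow> real^'n) \<Rightarrow> real^'l \<Rightarrow> real^'m \<Rightarrow> real^'n"
    and f0 :: "real \<Rightarrow> real^'n \<Rightarrow> (real \<Rightarrow> real^'n) \<Rightarrow> real^'l \<Rightarrow> real^'m \<Rightarrow> real"
    and \<sigma> :: "real^'n \<Rightarrow> (real \<Rightarrow> real^'n) \<Rightarrow> real"
    and \<phi> :: "real \<Rightarrow> real^'n \<Rightarrow> (real \<Rightarrow> real^'n) \<Rightarrow> real"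
  assumes "t0 < \<theta>" and "h > 0"
    and "compact U" and "U \<noteq> {}" and "compact V" and "V \<noteq> {}"
    and f_cont: "\<And>x r. r \<in> PC h \<Longrightarrow>
          continuous_on ({t0..\<theta>} \<times> UNIV \<times> UNIV) (\<lambda>(t, u, v). f t x r u v)"
    and f0_cont: "\<And>x r. r \<in> PC h \<Longrightarrow>
          continuous_on ({t0..\<theta>} \<times> UNIV \<times> UNIV) (\<lambda>(t, u, v). f0 t x r u v)"
    and growth: "\<exists>c>0. \<forall>(t, x, r)\<in>GG t0 \<theta> h. \<forall>u\<in>U. \<forall>v\<in>V.
          norm (f t x r u v) + \<bar>f0 t x r u v\<bar>
            \<le> c * (1 + norm x + norm_1 h r + norm (r (-h)))"
    and lipschitz: "\<forall>\<alpha>>0. \<exists>L>0. \<forall>t\<in>{t0..\<theta>}. \<forall>(x, r)\<in>PB h \<alpha>. \<forall>(x', r')\<in>PB h \<alpha>.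
          \<forall>u\<in>U. \<forall>v\<in>V.
          norm (f t x r u v - f t x' r' u v) + \<bar>f0 t x r u v - f0 t x' r' u v\<bar>
            \<le> L * (norm (x - x') + norm_1 h (\<lambda>\<xi>. r \<xi> - r' \<xi>) + norm (r (-h) - r' (-h)))"
    and saddle: "\<forall>(t, x, r)\<in>GG t0 \<theta> h. \<forall>s.
          minmax U V (\<lambda>u v. f t x r u v \<bullet> s + f0 t x r u v) =
          maxmin U V (\<lambda>u v. f t x r u v \<bullet> s + f0 t x r u v)"
    and sigma_lipschitz: "\<forall>\<alpha>>0. \<exists>L>0. \<forall>(x, r)\<in>PB h \<alpha>. \<forall>(x', r')\<in>PB h \<alpha>.
          \<bar>\<sigma> x r - \<sigma> x' r'\<bar> \<le> L * (norm (x - x') + norm_1 h (\<lambda>\<xi>. r \<xi> - r' \<xi>))"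
    and "\<phi> \<in> Phi t0 \<theta> h"
  shows "viscosity_solution t0 \<theta> h (hamiltonian U V f f0) \<sigma> \<phi> \<longleftrightarrow>
     (\<forall>z. \<forall>w\<in>PC h. \<phi> \<theta> z w = \<sigma> z w) \<and>
     (\<forall>(\<tau>, z, w)\<in>GG t0 \<theta> h. \<tau> < \<theta> \<longrightarrow>
        (\<forall>(p0, p)\<in>D_minus \<theta> h \<phi> \<tau> z w. p0 + hamiltonian U V f f0 \<tau> z w p \<le> 0) \<and>
        (\<forall>(q0, q)\<in>D_plus \<theta> h \<phi> \<tau> z w. q0 + hamiltonian U V f f0 \<tau> z w q \<ge> 0))"
proof -
  let ?H = "hamiltonian U V f f0"
  \<comment> \<open>The characterizations replace each slope pair by the derivatives of a test
    function, so a condition on all pairs becomes one on all test functions and radii.\<close>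
  have minus: "(\<forall>(p0, p)\<in>D_minus \<theta> h \<phi> \<tau> z w. p0 + ?H \<tau> z w p \<le> 0) \<longleftrightarrow>
      (\<forall>\<psi>. \<forall>\<delta>>0. continuously_differentiable \<psi> \<longrightarrow> touches_below \<theta> h \<phi> \<tau> z w \<delta> \<psi> \<longrightarrow>
         partial_t \<psi> \<tau> z + ?H \<tau> z w (grad_z \<psi> \<tau> z) \<le> 0)"
    and plus: "(\<forall>(q0, q)\<in>D_plus \<theta> h \<phi> \<tau> z w. q0 + ?H \<tau> z w q \<ge> 0) \<longleftrightarrow>
      (\<forall>\<psi>. \<forall>\<delta>>0. continuously_differentiable \<psi> \<longrightarrow>
         touches_below \<theta> h (\<lambda>t x r. - \<phi> t x r) \<tau> z w \<delta> (\<lambda>y. - \<psi> y) \<longrightarrow>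
         partial_t \<psi> \<tau> z + ?H \<tau> z w (grad_z \<psi> \<tau> z) \<ge> 0)"
    if "w \<in> PC h" for \<tau> z w
    unfolding Ball_def split_paired_All case_prod_conv
      D_minus_characterization[OF that] D_plus_characterization[OF that] by blast+
  \<comment> \<open>Changing both signs reverses the inequality, which is the premise of the
    supersolution-free half (b) of the definition.\<close>
  have above: "touches_below \<theta> h (\<lambda>t x r. - \<phi> t x r) \<tau> z w \<delta> (\<lambda>y. - \<psi> y) \<longleftrightarrow>
      (\<forall>(t, x)\<in>O_plus \<theta> \<delta> \<tau> z.
         \<phi> \<tau> z w - \<psi> (\<tau>, z) \<ge> \<phi> t x (segment h t (const_ext \<tau> z w)) - \<psi> (t, x))" for \<tau> z w \<delta> \<psi>
    unfolding touches_below_def by (rule ball_cong) auto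
  have pointwise: "(\<forall>\<psi>::real \<times> (real^'n) \<Rightarrow> real. \<forall>\<delta>>0. continuously_differentiable \<psi> \<longrightarrow>
         (touches_below \<theta> h \<phi> \<tau> z w \<delta> \<psi> \<longrightarrow>
           partial_t \<psi> \<tau> z + ?H \<tau> z w (grad_z \<psi> \<tau> z) \<le> 0) \<and>
         (touches_below \<theta> h (\<lambda>t x r. - \<phi> t x r) \<tau> z w \<delta> (\<lambda>y. - \<psi> y) \<longrightarrow>
           partial_t \<psi> \<tau> z + ?H \<tau> z w (grad_z \<psi> \<tau> z) \<ge> 0)) \<longleftrightarrow>
      (\<forall>(p0, p)\<in>D_minus \<theta> h \<phi> \<tau> z w. p0 + ?H \<tau> z w p \<le> 0) \<and>
      (\<forall>(q0, q)\<in>D_plus \<theta> h \<phi> \<tau> z w. q0 + ?H \<tau> z w q \<ge> 0)" if "w \<in> PC h" for \<tau> z w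
    unfolding minus[OF that] plus[OF that] by blast
  have "viscosity_solution t0 \<theta> h ?H \<sigma> \<phi> \<longleftrightarrow>
      (\<forall>z. \<forall>w\<in>PC h. \<phi> \<theta> z w = \<sigma> z w) \<and>
      (\<forall>(\<tau>, z, w)\<in>GG t0 \<theta> h. \<tau> < \<theta> \<longrightarrow>
        (\<forall>\<psi>::real \<times> (real^'n) \<Rightarrow> real. \<forall>\<delta>>0. continuously_differentiable \<psi> \<longrightarrow>
         (touches_below \<theta> h \<phi> \<tau> z w \<delta> \<psi> \<longrightarrow>
           partial_t \<psi> \<tau> z + ?H \<tau> z w (grad_z \<psi> \<tau> z) \<le> 0) \<and>
         (touches_below \<theta> h (\<lambda>t x r. - \<phi> t x r) \<tau> z w \<delta> (\<lambda>y. - \<psi> y) \<longrightarrow>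
           partial_t \<psi> \<tau> z + ?H \<tau> z w (grad_z \<psi> \<tau> z) \<ge> 0)))"
    unfolding viscosity_solution_def above unfolding touches_below_def
    using \<open>\<phi> \<in> Phi t0 \<theta> h\<close> by (simp only: simp_thms)
  also have "\<dots> \<longleftrightarrow> (\<forall>z. \<forall>w\<in>PC h. \<phi> \<theta> z w = \<sigma> z w) \<and>
     (\<forall>(\<tau>, z, w)\<in>GG t0 \<theta> h. \<tau> < \<theta> \<longrightarrow>
        (\<forall>(p0, p)\<in>D_minus \<theta> h \<phi> \<tau> z w. p0 + ?H \<tau> z w p \<le> 0) \<and>
        (\<forall>(q0, q)\<in>D_plus \<theta> h \<phi> \<tau> z w. q0 + ?H \<tau> z w q \<ge> 0))"
    \<comment> \<open>Membership in \<open>GG\<close> supplies \<open>w \<in> PC h\<close>, the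
      premise of the pointwise equivalence.\<close>
    using pointwise by (intro conj_cong refl ball_cong) (auto simp only: GG_def mem_Times_iff case_prod_unfold fst_conv snd_conv)
  finally show ?thesis .
qed

end
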